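(* Let $n\ge 1$, let $\mathbf{m}=(m_1,\ldots,m_n)$ be a vector of positive integers, and let $m=m_1+m_2+\cdots+m_n$. Let $$S_{\mathbf{m}}(x,y,z)=\sum_{\pi\in\mathcal{Q}_{\mathbf{m}}}x^{\mathrm{asc}(\pi)}y^{\mathrm{des}(\pi)}z^{\mathrm{plat}(\pi)}.$$ Then the polynomial $S_{\mathbf{m}}(x,y,z)$ is partial $\gamma$-positive and has the expansion $$S_{\mathbf{m}}(x,y,z)=\sum_{i=0}^{m-1}z^i\sum_{j=1}^{\lfloor\frac{m+1-i}{2}\rfloor}\gamma_{\mathbf{m},i,j}\,(xy)^j(x+y)^{m+1-i-2j},$$ where $$\gamma_{\mathbf{m},i,j}=\#\{\pi\in\mathcal{Q}_{\mathbf{m}}:\ \mathrm{sddes}(\pi)=\mathrm{fdesp}(\pi)=0,\ \mathrm{mdup}(\pi)=i,\ \mathrm{ascpp}(\pi)=j\}.$$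
   Context: Notation: $[k]=\{1,\ldots,k\}$. For a vector $\mathbf{m}=(m_1,\ldots,m_n)$ of positive integers, $M_{\mathbf{m}}=\{1^{m_1},2^{m_2},\ldots,n^{m_n}\}$ is the multiset in which $i$ appears $m_i$ times. A generalized Stirling permutation of $M_{\mathbf{m}}$ is a word $\pi=\pi_1\pi_2\cdots\pi_m$ (with $m=\sum_i m_i$) that is a permutation of the multiset $M_{\mathbf{m}}$ such that, for each $i\in[n]$, all entries located between any two occurrences of $i$ are larger than or equal to $i$ (equivalently, all entries different from $i$ between two occurrences of $i$ are larger than $i$). $\mathcal{Q}_{\mathbf{m}}$ denotes the set of all generalized Stirling permutations of $M_{\mathbf{m}}$. Convention: $\pi_0=\pi_{m+1}=0$. An index $i$, $0\le i\le m$, is an ascent (resp. plateau, descent) of $\pi$ if $\pi_i<\pi_{i+1}$ (resp. $\pi_i=\pi_{i+1}$, $\pi_i>\pi_{i+1}$). $\mathrm{asc}(\pi)$, $\mathrm{plat}(\pi)$, $\mathrm{des}(\pi)$ are the numbers of ascents, plateaux, descents of $\pi$. A letter $k\in[n]$ is multiple if $m_k>1$ and single if $m_k=1$. An index $i\in[m]$ is a multiple descent of $\pi$ if $\pi_i>\pi_{i+1}$ and $\pi_i$ is multiple. An index $i\in[m]$ is an ascent-plateau if $\pi_{i-1}<\pi_i=\pi_{i+1}$; it is a descent-plateau if $\pi_{i-1}>\pi_i=\pi_{i+1}$; a descent-plateau $i$ is free if there is no $\ell$ with $1\le\ell<i$ and $\pi_\ell=\pi_i$. A plateau $i$ is unmovable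 if it is neither a free descent-plateau nor an ascent-plateau. Define: - $\mathrm{sddes}(\pi)=\#\{i\in[m]:\pi_{i-1}>\pi_i>\pi_{i+1}\text{ and }\pi_i\text{ is single}\}$; - $\mathrm{fdesp}(\pi)=\#\{i\in[m]:\pi_{i-1}>\pi_i=\pi_{i+1}\text{ and }\pi_\ell\ne\pi_i\text{ for all }\ell\in[i-1]\}$; - $\mathrm{ascpp}(\pi)=\#\{i\in[m]:\pi_{i-1}<\pi_i=\pi_{i+1}\text{ or }\pi_{i-1}<\pi_i>\pi_{i+1}\}$; - $\mathrm{mdup}(\pi)=\#\{i\in[m]: i\text{ is a multiple descent or an unmovable plateau}\}$. A bivariate polynomial $h(x,y)$ is homogeneous $\gamma$-positive if, for some integer $N\ge 0$, it can be written as $h(x,y)=\sum_{k=0}^{\lfloor N/2\rfloor}\gamma_k(xy)^k(x+y)^{N-2k}$ with all $\gamma_k\ge0$. A trivariate polynomial $p(x,y,z)=\sum_i s_i(x,y)z^i$ is partial $\gamma$-positive if every $s_i(x,y)$ is homogeneous $\gamma$-positive. *)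

theory Defs
  imports
    "HOL-Computational_Algebra.Polynomial"
    "HOL-Combinatorics.Multiset_Permutations"
begin

text \<open>A vector \<open>(m\<^sub>1, \<dots>, m\<^sub>n)\<close> is given by \<open>n\<close> and a function \<open>m\<close>, of which only the
  values on \<open>{1..n}\<close> matter.  A word is a list of naturals; positions are counted from 1,
  with the convention that the entries at positions \<open>0\<close> and \<open>length w + 1\<close> are \<open>0\<close>.\<close>

definition entry :: "nat list \<Rightarrow> nat \<Rightarrow> nat" where
  "entry w i = (if 1 \<le> i \<and> i \<le> length w then w ! (i - 1) else 0)"

definition letter_mset :: "nat \<Rightarrow> (nat \<Rightarrow> nat) \<Rightarrow> nat multiset" where
  "letter_mset n m = (\<Sum>i=1..n. replicate_mset (m i) i)"

definition stirling_perms :: "nat \<Rightarrow> (nat \<Rightarrow> nat) \<Rightarrow> nat list set" where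
  "stirling_perms n m =
    {w \<in> permutations_of_multiset (letter_mset n m).
      \<forall>i\<in>{1..n}. \<forall>a b c. 1 \<le> a \<and> a < b \<and> b < c \<and> c \<le> length w \<and>
        entry w a = i \<and> entry w c = i \<longrightarrow> entry w b \<ge> i}"

definition asc :: "nat list \<Rightarrow> nat" where
  "asc w = card {i \<in> {0..length w}. entry w i < entry w (i + 1)}"

definition plat :: "nat list \<Rightarrow> nat" where
  "plat w = card {i \<in> {0..length w}. entry w i = entry w (i + 1)}"

definition des :: "nat list \<Rightarrow> nat" where
  "des w = card {i \<in> {0..length w}. entry w i > entry w (i + 1)}"

definition multiple_letter :: "(nat \<Rightarrow> nat) \<Rightarrow> nat \<Rightarrow> bool" where
  "multiple_letter m k \<longleftrightarrow> m k > 1"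

definition single_letter :: "(nat \<Rightarrow> nat) \<Rightarrow> nat \<Rightarrow> bool" where
  "single_letter m k \<longleftrightarrow> m k = 1"

definition plateau :: "nat list \<Rightarrow> nat \<Rightarrow> bool" where
  "plateau w i \<longleftrightarrow> entry w i = entry w (i + 1)"

definition multiple_descent :: "(nat \<Rightarrow> nat) \<Rightarrow> nat list \<Rightarrow> nat \<Rightarrow> bool" where
  "multiple_descent m w i \<longleftrightarrow> entry w i > entry w (i + 1) \<and> multiple_letter m (entry w i)"

definition ascent_plateau :: "nat list \<Rightarrow> nat \<Rightarrow> bool" where
  "ascent_plateau w i \<longleftrightarrow> entry w (i - 1) < entry w i \<and> entry w i = entry w (i + 1)"

definition descent_plateau :: "nat list \<Rightarrow> nat \<Rightarrow> bool" where
  "descent_plateau w i \<longleftrightarrow> entry w (i - 1) > entry w i \<and> entry w i = entry w (i + 1)"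

definition free_descent_plateau :: "nat list \<Rightarrow> nat \<Rightarrow> bool" where
  "free_descent_plateau w i \<longleftrightarrow>
    descent_plateau w i \<and> \<not> (\<exists>l. 1 \<le> l \<and> l < i \<and> entry w l = entry w i)"

definition unmovable_plateau :: "nat list \<Rightarrow> nat \<Rightarrow> bool" where
  "unmovable_plateau w i \<longleftrightarrow>
    plateau w i \<and> \<not> free_descent_plateau w i \<and> \<not> ascent_plateau w i"

definition sddes :: "(nat \<Rightarrow> nat) \<Rightarrow> nat list \<Rightarrow> nat" where
  "sddes m w = card {i \<in> {1..length w}.
    entry w (i - 1) > entry w i \<and> entry w i > entry w (i + 1) \<and> single_letter m (entry w i)}"

definition fdesp :: "nat list \<Rightarrow> nat" where
  "fdesp w = card {i \<in> {1..length w}. free_descent_plateau w i}"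

definition ascpp :: "nat list \<Rightarrow> nat" where
  "ascpp w = card {i \<in> {1..length w}.
    ascent_plateau w i \<or> (entry w (i - 1) < entry w i \<and> entry w i > entry w (i + 1))}"

definition mdup :: "(nat \<Rightarrow> nat) \<Rightarrow> nat list \<Rightarrow> nat" where
  "mdup m w = card {i \<in> {1..length w}. multiple_descent m w i \<or> unmovable_plateau w i}"

text \<open>Bivariate polynomials are elements of \<open>\<real>[x][y]\<close>, trivariate ones elements of
  \<open>\<real>[x][y][z]\<close>.  As \<open>z\<close> is the outermost variable, \<open>coeff p i\<close> is the polynomial
  \<open>s\<^sub>i(x,y)\<close> in \<open>p = \<Sum>\<^sub>i s\<^sub>i(x,y) z\<^sup>i\<close>.\<close>

definition X2 :: "real poly poly" where "X2 = [:[:0, 1:]:]"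
definition Y2 :: "real poly poly" where "Y2 = [:0, 1:]"

definition X3 :: "real poly poly poly" where "X3 = [:X2:]"
definition Y3 :: "real poly poly poly" where "Y3 = [:Y2:]"
definition Z3 :: "real poly poly poly" where "Z3 = [:0, 1:]"

definition homogeneous_gamma_positive :: "real poly poly \<Rightarrow> bool" where
  "homogeneous_gamma_positive h \<longleftrightarrow>
    (\<exists>(N::nat) (\<gamma>::nat \<Rightarrow> real). (\<forall>k\<in>{0..N div 2}. \<gamma> k \<ge> 0) \<and>
      h = (\<Sum>k=0..N div 2. [:[:\<gamma> k:]:] * (X2 * Y2) ^ k * (X2 + Y2) ^ (N - 2 * k)))"

definition partial_gamma_positive :: "real poly poly poly \<Rightarrow> bool" where
  "partial_gamma_positive p \<longleftrightarrow> (\<forall>i. homogeneous_gamma_positive (coeff p i))"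

definition stirling_poly :: "nat \<Rightarrow> (nat \<Rightarrow> nat) \<Rightarrow> real poly poly poly" where
  "stirling_poly n m = (\<Sum>w\<in>stirling_perms n m. X3 ^ asc w * Y3 ^ des w * Z3 ^ plat w)"

definition gamma_coeff :: "nat \<Rightarrow> (nat \<Rightarrow> nat) \<Rightarrow> nat \<Rightarrow> nat \<Rightarrow> nat" where
  "gamma_coeff n m i j = card {w \<in> stirling_perms n m.
    sddes m w = 0 \<and> fdesp w = 0 \<and> mdup m w = i \<and> ascpp w = j}"

end

theory Submission
  imports Defs
begin

text \<open>All entries between two copies of the largest letter \<open>N\<close> are equal to \<open>N\<close>, so the copies of
  \<open>N\<close> form one block.  Hence every generalized Stirling permutation on \<open>N\<close> letters arises in a
  unique way by inserting a block of \<open>k = m N\<close> copies of \<open>N\<close> into a gap of one on \<open>N - 1\<close> letters;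
  the gap \<open>g\<close> lies between the positions \<open>g\<close> and \<open>g + 1\<close> (sum_stirling_perms_Suc).  The proof
  follows two families of statistics through this insertion.

  First, the gap \<open>g\<close> is destroyed, and one ascent, one descent and \<open>k - 1\<close> plateaux appear.  This
  gives a recursion for the joint distribution of (asc, des, plat) (sum_step_insert).

  Second, every index of a nonempty word is an ascent, a top (counted by ascpp), a fall (counted by
  sddes or fdesp), or of the remaining kind (counted by mdup).  Each top is preceded by an ascent, so
  there are \<open>a + b\<close> ascents if there are \<open>a\<close> tops.  Mark a word with \<open>c\<close> falls and \<open>d\<close> remaining
  indices by the monomial \<open>p\<^sup>a u\<^sup>b v\<^sup>c z\<^sup>d\<close>; a factor \<open>p\<close> stands for a top together with its ascent.
  Inserting the block in all gaps acts on these monomials as the derivation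
  \<open>p \<rightarrow> p (u + v) z\<^sup>k\<^sup>-\<^sup>1\<close>, \<open>u, v, z \<rightarrow> p z\<^sup>k\<^sup>-\<^sup>1\<close> (state_insert).  Two consequences carry the theorem.

  \<^item> The triples (asc, des, plat) and \<open>(a + b, a + c, d)\<close> satisfy the same recursion and are
    equidistributed (asc_des_plat_equidistributed).

  \<^item> The sum of the monomials depends on \<open>u\<close> and \<open>v\<close> only through \<open>u + v\<close>, so its value at
    \<open>(p, u, v) = (x y, x, y)\<close> is its value at \<open>(x y, x + y, 0)\<close>, to which just the words without
    falls contribute (stirling_sum_gamma).

  Grouping these words by mdup and ascpp yields the expansion.\<close>

section \<open>Inserting a block of equal letters\<close>

text \<open>The word obtained from \<open>w\<close> by inserting \<open>k\<close> copies of \<open>N\<close> after its first \<open>g\<close> entries.\<close>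
definition ins_block :: "nat \<Rightarrow> nat \<Rightarrow> nat \<Rightarrow> nat list \<Rightarrow> nat list" where
  "ins_block N k g w = take g w @ replicate k N @ drop g w"

text \<open>The index in the new word of the entry that had index \<open>i\<close> in the old one.\<close>
definition bump :: "nat \<Rightarrow> nat \<Rightarrow> nat \<Rightarrow> nat" where
  "bump g k i = (if i \<le> g then i else i + k)"

lemma length_ins_block [simp]: "g \<le> length w \<Longrightarrow> length (ins_block N k g w) = length w + k"
  by (simp add: ins_block_def)

lemma inj_bump: "inj (bump g k)"
  by (auto simp: inj_def bump_def split: if_splits)

lemma bump_less_iff [simp]: "bump g k a < bump g k b \<longleftrightarrow> a < b"
  by (auto simp: bump_def)

lemma entry_ins_block_block:
  "g \<le> length w \<Longrightarrow> g < x \<Longrightarrow> x \<le> g + k \<Longrightarrow> entry (ins_block N k g w) x = N"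
  by (auto simp: entry_def ins_block_def nth_append)

lemma entry_ins_block_bump:
  "g \<le> length w \<Longrightarrow> entry (ins_block N k g w) (bump g k i) = entry w i"
  by (auto simp: entry_def ins_block_def bump_def nth_append min_def)

lemma entry_ins_block_low:
  "g \<le> length w \<Longrightarrow> i \<le> g \<Longrightarrow> entry (ins_block N k g w) i = entry w i"
  using entry_ins_block_bump[of g w N k i] by (simp add: bump_def)

lemma entry_ins_block_high:
  "g \<le> length w \<Longrightarrow> g < i \<Longrightarrow> entry (ins_block N k g w) (i + k) = entry w i"
  using entry_ins_block_bump[of g w N k i] by (simp add: bump_def)

text \<open>The indices of a word with an inserted block: \<open>g\<close> now precedes the block, \<open>g + 1, \<dots>, g + k\<close> are the
  block, and the later ones are old indices shifted by \<open>k\<close>.\<close>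
lemma index_cases:
  fixes x g k :: nat
  obtains (low) "x < g" | (gap) "x = g" | (block) "g < x" "x \<le> g + k"
    | (high) i where "x = i + k" "g < i"
proof -
  consider "x < g" | "x = g" | "g < x \<and> x \<le> g + k" | "g + k < x" by linarith
  then show ?thesis
  proof cases
    case 3
    then show ?thesis using block by blast
  next
    case 4
    then have "x = (x - k) + k" "g < x - k" by auto
    then show ?thesis by (rule high)
  qed (use low gap in auto)
qed

section \<open>The four kinds of indices\<close>

text \<open>The indices counted by \<^const>\<open>ascpp\<close>: a letter reached by an ascent and not left by one.\<close>
definition tops :: "nat list \<Rightarrow> nat set" where
  "tops w = {i \<in> {1..length w}. entry w (i - 1) < entry w i \<and> entry w (i + 1) \<le> entry w i}"

text \<open>The indices counted by \<^const>\<open>sddes\<close> or \<^const>\<open>fdesp\<close>.\<close>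
definition falls :: "(nat \<Rightarrow> nat) \<Rightarrow> nat list \<Rightarrow> nat set" where
  "falls m w = {i \<in> {1..length w}.
     (entry w (i - 1) > entry w i \<and> entry w i > entry w (i + 1) \<and> single_letter m (entry w i))
     \<or> free_descent_plateau w i}"

text \<open>The indices of ascents and descents, including the index 0.\<close>
definition ascents :: "nat list \<Rightarrow> nat set" where
  "ascents w = {i \<in> {0..length w}. entry w i < entry w (i + 1)}"

definition descents :: "nat list \<Rightarrow> nat set" where
  "descents w = {i \<in> {0..length w}. entry w i > entry w (i + 1)}"

text \<open>The number of indices that are neither ascents, nor tops, nor falls.  For nonempty words in
  \<^const>\<open>stirling_perms\<close> this is \<^const>\<open>mdup\<close>, but for the empty word it is 1: the only index 0 is a
  plateau, which \<^const>\<open>mdup\<close> does not see.  This value starts the recursion.\<close>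
definition rest :: "(nat \<Rightarrow> nat) \<Rightarrow> nat list \<Rightarrow> nat" where
  "rest m w = card ({0..length w} - ascents w - tops w - falls m w)"

lemma card_pos_if_mem: "x \<in> A \<Longrightarrow> finite A \<Longrightarrow> 1 \<le> card A"
  by (metis One_nat_def Suc_leI card_gt_0_iff empty_iff)

lemma finite_index_sets [simp]:
  "finite (tops w)" "finite (falls m w)" "finite (ascents w)" "finite (descents w)"
  by (simp_all add: tops_def falls_def ascents_def descents_def)

lemma index_sets_subset:
  "tops w \<subseteq> {0..length w}" "falls m w \<subseteq> {0..length w}" "ascents w \<subseteq> {0..length w}"
  "descents w \<subseteq> {0..length w}"
  by (auto simp: tops_def falls_def ascents_def descents_def)

lemma index_sets_disjoint:
  "ascents w \<inter> tops w = {}" "ascents w \<inter> falls m w = {}" "tops w \<inter> falls m w = {}"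
  "ascents w \<inter> descents w = {}"
  by (auto simp: tops_def falls_def ascents_def descents_def free_descent_plateau_def descent_plateau_def)

lemma asc_eq: "asc w = card (ascents w)" by (simp add: asc_def ascents_def)
lemma des_eq: "des w = card (descents w)" by (simp add: des_def descents_def)

lemma ascpp_eq: "ascpp w = card (tops w)"
  unfolding ascpp_def tops_def ascent_plateau_def by (rule arg_cong[of _ _ card]) auto

lemma falls_eq: "card (falls m w) = sddes m w + fdesp w"
proof -
  let ?A = "{i \<in> {1..length w}.
    entry w (i - 1) > entry w i \<and> entry w i > entry w (i + 1) \<and> single_letter m (entry w i)}"
  let ?B = "{i \<in> {1..length w}. free_descent_plateau w i}"
  have "card (?A \<union> ?B) = card ?A + card ?B"
    by (rule card_Un_disjoint) (auto simp: free_descent_plateau_def descent_plateau_def)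
  moreover have "falls m w = ?A \<union> ?B" by (auto simp: falls_def)
  ultimately show ?thesis by (simp add: sddes_def fdesp_def)
qed

lemma total_kinds: "asc w + card (tops w) + card (falls m w) + rest m w = length w + 1"
proof -
  let ?I = "{0..length w}"
  note s = index_sets_subset(1,3)[of w] index_sets_subset(2)[of m w]
  have 1: "card (?I - ascents w) = card ?I - card (ascents w)" "card (ascents w) \<le> card ?I"
    by (intro card_Diff_subset card_mono s finite_index_sets finite_atLeastAtMost)+
  have 2: "card (?I - ascents w - tops w) = card (?I - ascents w) - card (tops w)"
    "card (tops w) \<le> card (?I - ascents w)"
    using s index_sets_disjoint(1,4)[of w] index_sets_disjoint(2,3)[of w m] by (auto intro!: card_Diff_subset card_mono)
  have 3: "card (?I - ascents w - tops w - falls m w) = card (?I - ascents w - tops w) - card (falls m w)"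
    "card (falls m w) \<le> card (?I - ascents w - tops w)"
    using s index_sets_disjoint(1,4)[of w] index_sets_disjoint(2,3)[of w m] by (auto intro!: card_Diff_subset card_mono)
  show ?thesis using 1 2 3 by (simp add: rest_def asc_eq)
qed

lemma total_steps: "asc w + des w + plat w = length w + 1"
proof -
  let ?C = "{i \<in> {0..length w}. entry w i = entry w (i + 1)}"
  have "card (ascents w \<union> descents w \<union> ?C) = card (ascents w) + card (descents w) + card ?C"
    using index_sets_disjoint(4)[of w]
    by (subst card_Un_disjoint) (auto simp: ascents_def descents_def intro!: card_Un_disjoint)
  moreover have "ascents w \<union> descents w \<union> ?C = {0..length w}"
    by (auto simp: ascents_def descents_def)
  ultimately show ?thesis by (simp add: asc_eq des_eq plat_def)
qed

lemma pred_tops: "{g \<in> {0..length w}. Suc g \<in> tops w} = (\<lambda>i. i - 1) ` tops w"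
  by (force simp: tops_def image_iff)

lemma card_pred_tops: "card {g \<in> {0..length w}. Suc g \<in> tops w} = card (tops w)"
  unfolding pred_tops by (rule card_image) (auto simp: inj_on_def tops_def)

lemma pred_tops_subset: "{g \<in> {0..length w}. Suc g \<in> tops w} \<subseteq> ascents w"
  by (auto simp: tops_def ascents_def)

lemma tops_le_asc: "card (tops w) \<le> asc w"
  unfolding asc_eq card_pred_tops[of w, symmetric] by (rule card_mono[OF _ pred_tops_subset]) simp

section \<open>Generalized Stirling permutations\<close>

lemma count_letter_mset:
  "count (letter_mset n m) k = (if k \<in> {1..n} then m k else 0)"
  by (auto simp: letter_mset_def count_sum)

lemma letter_mset_Suc: "letter_mset (Suc n) m = letter_mset n m + replicate_mset (m (Suc n)) (Suc n)"
  by (simp add: letter_mset_def)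

lemma stirling_mset: "w \<in> stirling_perms n m \<Longrightarrow> mset w = letter_mset n m"
  by (simp add: stirling_perms_def permutations_of_multiset_def)

lemma stirling_set: "w \<in> stirling_perms n m \<Longrightarrow> set w \<subseteq> {1..n}"
proof
  fix x assume w: "w \<in> stirling_perms n m" and "x \<in> set w"
  then have "count (letter_mset n m) x \<noteq> 0" using stirling_mset[OF w] by (metis count_mset_0_iff)
  then show "x \<in> {1..n}" by (auto simp: count_letter_mset split: if_splits)
qed

lemma stirling_length: "w \<in> stirling_perms n m \<Longrightarrow> length w = (\<Sum>i=1..n. m i)"
  using arg_cong[OF stirling_mset, of w n m size] by (simp add: letter_mset_def size_multiset_sum)

lemma stirling_entry:
  assumes "w \<in> stirling_perms n m" "1 \<le> i" "i \<le> length w"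
  shows "1 \<le> entry w i" "entry w i \<le> n"
proof -
  have "w ! (i - 1) \<in> set w" using assms by auto
  then show "1 \<le> entry w i" "entry w i \<le> n" using stirling_set[OF assms(1)] assms by (auto simp: entry_def subset_iff)
qed

lemma entry_le: "w \<in> stirling_perms n m \<Longrightarrow> entry w i \<le> n"
  using stirling_entry[of w n m i] by (cases "1 \<le> i \<and> i \<le> length w") (auto simp: entry_def)

lemma stirling_between:
  assumes "w \<in> stirling_perms n m" "1 \<le> a" "a < b" "b < c" "c \<le> length w" "entry w a = entry w c"
  shows "entry w a \<le> entry w b"
proof -
  have "entry w a \<in> {1..n}" using stirling_entry[OF assms(1), of a] assms by auto
  then show ?thesis using assms unfolding stirling_perms_def by fastforce
qed

lemma card_occurrences:
  assumes "w \<in> stirling_perms n m" "k \<in> {1..n}"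
  shows "card {i \<in> {1..length w}. entry w i = k} = m k"
proof -
  have "{i \<in> {1..length w}. entry w i = k} = Suc ` {i. i < length w \<and> w ! i = k}"
  proof (intro set_eqI iffI)
    fix x assume "x \<in> {i \<in> {1..length w}. entry w i = k}"
    then have "x = Suc (x - 1)" "x - 1 < length w" "w ! (x - 1) = k" by (auto simp: entry_def)
    then show "x \<in> Suc ` {i. i < length w \<and> w ! i = k}" by blast
  qed (auto simp: entry_def)
  then have "card {i \<in> {1..length w}. entry w i = k} = length (filter (\<lambda>x. x = k) w)"
    by (simp add: card_image length_filter_conv_card)
  also have "\<dots> = count (mset w) k" by (induction w) auto
  finally show ?thesis using assms by (simp add: stirling_mset count_letter_mset)
qed

text \<open>Otherwise the smaller entry \<open>entry w (i - 1)\<close> would lie between two copies of \<open>entry w i\<close>.\<close>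
lemma rise_is_first:
  assumes w: "w \<in> stirling_perms n m" and i: "1 \<le> l" "l < i" "i \<le> length w"
    and "entry w (i - 1) < entry w i"
  shows "entry w l \<noteq> entry w i"
proof
  assume eq: "entry w l = entry w i"
  then have "l \<noteq> i - 1" using assms(5) by auto
  then have "l < i - 1" using i by linarith
  then have "entry w l \<le> entry w (i - 1)" using stirling_between[OF w, of l "i - 1" i] eq i by simp
  then show False using eq assms by simp
qed

text \<open>A letter entered by an ascent is its first occurrence, and by the mirror argument a letter left
  by a descent is its last one.  Hence an index is never counted by both \<^const>\<open>ascpp\<close> and
  \<^const>\<open>mdup\<close>.\<close>
lemma peak_is_single:
  assumes w: "w \<in> stirling_perms n m" and i: "1 \<le> i" "i \<le> length w"
    and pk: "entry w (i - 1) < entry w i" "entry w (i + 1) < entry w i"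
  shows "m (entry w i) = 1"
proof -
  have "l = i" if l: "l \<in> {1..length w}" "entry w l = entry w i" for l
  proof (rule ccontr)
    assume "l \<noteq> i"
    moreover have "\<not> l < i" using rise_is_first[OF w, of l i] l i pk by auto
    ultimately have "i < l" by simp
    moreover have "l \<noteq> i + 1" using l pk by auto
    ultimately have "i + 1 < l" by simp
    then show False using stirling_between[OF w, of i "i + 1" l] l i pk by auto
  qed
  then have "{l \<in> {1..length w}. entry w l = entry w i} = {i}" using i by auto
  then show ?thesis using card_occurrences[OF w, of "entry w i"] stirling_entry[OF w i] by simp
qed

lemma repeated_not_single:
  assumes w: "w \<in> stirling_perms n m" and i: "1 \<le> i" "i \<le> length w"
    and eq: "entry w (i - 1) = entry w i"
  shows "1 < i" "m (entry w i) > 1"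
proof -
  show i1: "1 < i" using stirling_entry(1)[OF w i] eq i
    by (cases "i = 1") (auto simp: entry_def)
  have "card {i - 1, i} \<le> card {l \<in> {1..length w}. entry w l = entry w i}"
    by (rule card_mono) (use i i1 eq in auto)
  moreover have "card {i - 1, i} = 2" using i1 by simp
  ultimately show "m (entry w i) > 1"
    using card_occurrences[OF w, of "entry w i"] stirling_entry[OF w i] by simp
qed

lemma rest_eq_mdup:
  assumes w: "w \<in> stirling_perms n m" and m: "\<forall>i\<in>{1..n}. m i \<ge> 1" and n: "w \<noteq> []"
  shows "rest m w = mdup m w"
proof -
  have "{0..length w} - ascents w - tops w - falls m w
     = {i \<in> {1..length w}. multiple_descent m w i \<or> unmovable_plateau w i}" (is "?L = ?R")
  proof (rule set_eqI)
    fix i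
    show "i \<in> ?L \<longleftrightarrow> i \<in> ?R"
    proof (cases "1 \<le> i \<and> i \<le> length w")
      case False
      moreover have "0 \<in> ascents w"
        using stirling_entry(1)[OF w, of 1] n by (cases w) (auto simp: ascents_def entry_def)
      ultimately show ?thesis by (cases "i = 0") auto
    next
      case True
      then have i: "1 \<le> i" "i \<le> length w" by auto
      note pk = peak_is_single[OF w i] and rp = repeated_not_single[OF w i]
      have "m (entry w i) \<ge> 1" using m stirling_entry[OF w i] by auto
      then show ?thesis using i pk rp
        by (auto simp: ascents_def tops_def falls_def multiple_descent_def unmovable_plateau_def
           plateau_def ascent_plateau_def free_descent_plateau_def descent_plateau_def
           multiple_letter_def single_letter_def)
    qed
  qed
  then show ?thesis by (simp add: rest_def mdup_def)
qed

section \<open>The index sets after inserting the largest letter\<close>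

context
  fixes n m w g k w'
  assumes w: "w \<in> stirling_perms n m" and g: "g \<le> length w" and k: "k \<ge> 1" "k = m (Suc n)"
  defines "w' \<equiv> ins_block (Suc n) k g w"
begin

lemma entry_inserted:
  "length w' = length w + k"
  "i \<le> g \<Longrightarrow> entry w' i = entry w i"
  "g < i \<Longrightarrow> i \<le> g + k \<Longrightarrow> entry w' i = Suc n"
  "g < i \<Longrightarrow> entry w' (i + k) = entry w i"
  using g by (auto simp: w'_def entry_ins_block_block entry_ins_block_low entry_ins_block_high)

lemma entry_inserted':
  "g < i \<Longrightarrow> entry w' (Suc (i + k)) = entry w (Suc i)"
  "Suc g < i \<Longrightarrow> entry w' (i + k - Suc 0) = entry w (i - 1)"
  "entry w' (Suc g) = Suc n" "entry w' (g + k) = Suc n"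
  "entry w' (Suc (g + k)) = entry w (Suc g)"
  "entry w i < Suc n" "entry w i \<noteq> Suc n" "Suc n \<noteq> entry w i" "\<not> Suc n < entry w i" "\<not> Suc n \<le> entry w i"
  using entry_inserted(4)[of "Suc i"] entry_inserted(4)[of "i - 1"] entry_inserted(4)[of "Suc g"]
    entry_inserted(3)[of "Suc g"] entry_inserted(3)[of "g + k"] k entry_le[OF w, of i] by auto

lemma ascents_insert: "ascents w' = bump g k ` (ascents w - {g}) \<union> {g}"
proof (rule set_eqI)
  fix x
  show "x \<in> ascents w' \<longleftrightarrow> x \<in> bump g k ` (ascents w - {g}) \<union> {g}"
  proof (cases x rule: index_cases[where g = g and k = k])
    case block
    then have "x \<notin> bump g k ` (ascents w - {g}) \<union> {g}" by (auto simp: bump_def ascents_def split: if_splits)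
    moreover have "entry w' (Suc x) \<le> Suc n" using block entry_inserted(3)[of "Suc x"] entry_inserted'(5) entry_inserted'(6)[of "Suc g"]
      by (cases "x = g + k") auto
    ultimately show ?thesis using block entry_inserted(3)[of x] by (auto simp: ascents_def)
  next
    case (high i)
    then have "x \<in> bump g k ` (ascents w - {g}) \<union> {g} \<longleftrightarrow> i \<in> ascents w"
      by (auto simp: bump_def image_iff)
    then show ?thesis using high entry_inserted entry_inserted' by (auto simp: ascents_def)
  qed (use g entry_inserted entry_inserted' in \<open>auto simp: bump_def image_iff ascents_def\<close>)
qed

lemma descents_insert: "descents w' = bump g k ` (descents w - {g}) \<union> {g + k}"
proof (rule set_eqI)
  fix x
  show "x \<in> descents w' \<longleftrightarrow> x \<in> bump g k ` (descents w - {g}) \<union> {g + k}"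
  proof (cases x rule: index_cases[where g = g and k = k])
    case block
    then have "x \<notin> bump g k ` (descents w - {g})" by (auto simp: bump_def split: if_splits)
    then show ?thesis using g block entry_inserted(1) entry_inserted(3)[of x] entry_inserted(3)[of "Suc x"] entry_inserted'(5) entry_inserted'(6)[of "Suc g"]
      by (cases "x = g + k") (auto simp: descents_def)
  next
    case (high i)
    then have "x \<in> bump g k ` (descents w - {g}) \<union> {g + k} \<longleftrightarrow> i \<in> descents w"
      by (auto simp: bump_def image_iff)
    then show ?thesis using high entry_inserted entry_inserted' by (auto simp: descents_def)
  qed (use g k entry_inserted entry_inserted' in \<open>auto simp: bump_def image_iff descents_def\<close>)
qed

lemma tops_insert: "tops w' = bump g k ` (tops w - {g, Suc g}) \<union> {Suc g}"
proof (rule set_eqI)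
  fix x
  show "x \<in> tops w' \<longleftrightarrow> x \<in> bump g k ` (tops w - {g, Suc g}) \<union> {Suc g}"
  proof (cases x rule: index_cases[where g = g and k = k])
    case block
    then have "x \<notin> bump g k ` (tops w - {g, Suc g})" by (auto simp: bump_def split: if_splits)
    moreover have "entry w' (Suc x) \<le> Suc n" using block entry_inserted(3)[of "Suc x"] entry_inserted'(5) entry_inserted'(6)[of "Suc g"]
      by (cases "x = g + k") auto
    moreover have "entry w' (x - 1) < Suc n \<longleftrightarrow> x = Suc g"
      using block entry_inserted(2)[of g] entry_inserted(3)[of "x - 1"] entry_inserted'(6) by (cases "x = Suc g") auto
    ultimately show ?thesis using g block entry_inserted(1) entry_inserted(3)[of x] by (auto simp: tops_def)
  next
    case (high i)
    then have "x \<in> bump g k ` (tops w - {g, Suc g}) \<union> {Suc g} \<longleftrightarrow> i \<in> tops w \<and> i \<noteq> Suc g"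
      using k by (auto simp: bump_def image_iff)
    then show ?thesis using high entry_inserted entry_inserted' by (cases "i = Suc g") (auto simp: tops_def)
  qed (use g k entry_inserted entry_inserted' in \<open>auto simp: bump_def image_iff tops_def\<close>)
qed

text \<open>Only the index \<open>g + 1\<close> after the gap can become a fall, because its left neighbour grows.  It does
  so exactly when it was a top: a peak is a single letter and turns into a single double descent, an
  ascent-plateau starts with a first occurrence and turns into a free descent-plateau.\<close>
lemma falls_insert:
  "falls m w' = bump g k ` (falls m w - {g}) \<union> (if Suc g \<in> tops w then {Suc g + k} else {})"
proof (rule set_eqI)
  fix x
  show "x \<in> falls m w' \<longleftrightarrow> x \<in> bump g k ` (falls m w - {g}) \<union> (if Suc g \<in> tops w then {Suc g + k} else {})"
    (is "_ \<longleftrightarrow> x \<in> ?R")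
  proof (cases x rule: index_cases[where g = g and k = k])
    case low
    then have "x \<in> ?R \<longleftrightarrow> x \<in> falls m w"
      by (auto simp: bump_def image_iff)
    moreover have "(\<exists>l\<ge>1. l < x \<and> entry w' l = entry w' x) \<longleftrightarrow> (\<exists>l\<ge>1. l < x \<and> entry w l = entry w x)"
      using low by (auto simp: entry_inserted(2))
    ultimately show ?thesis using low g entry_inserted(1)
      by (auto simp: falls_def free_descent_plateau_def descent_plateau_def entry_inserted(2))
  next
    case gap
    then show ?thesis using entry_inserted entry_inserted'
      by (auto simp: bump_def image_iff falls_def free_descent_plateau_def descent_plateau_def)
  next
    case block
    then have "x \<notin> ?R" by (auto simp: bump_def split: if_splits)
    moreover have "entry w' (x - 1) \<le> Suc n"
      using block entry_inserted(2)[of g] entry_inserted(3)[of "x - 1"] entry_inserted'(6)[of g] by (cases "x = Suc g") auto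
    ultimately show ?thesis using block entry_inserted(3)[of x]
      by (auto simp: falls_def free_descent_plateau_def descent_plateau_def)
  next
    case (high i)
    then have R: "x \<in> ?R \<longleftrightarrow> i \<in> falls m w \<or> (i = Suc g \<and> Suc g \<in> tops w)"
      by (auto simp: bump_def image_iff)
    \<comment> \<open>Insertion does not affect whether an old entry is the first occurrence of its letter.\<close>
    have first: "(\<exists>l\<ge>1. l < x \<and> entry w' l = entry w' x) \<longleftrightarrow> (\<exists>l\<ge>1. l < i \<and> entry w l = entry w i)"
    proof
      assume "\<exists>l\<ge>1. l < x \<and> entry w' l = entry w' x"
      then obtain l where l: "l \<ge> 1" "l < x" "entry w' l = entry w' x" by blast
      have x: "entry w' x = entry w i" using high entry_inserted(4) by simp
      show "\<exists>l\<ge>1. l < i \<and> entry w l = entry w i"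
      proof (cases l rule: index_cases[where g = g and k = k])
        case block
        then show ?thesis using l x entry_inserted(3)[of l] entry_inserted'(8)[of i] by simp
      next
        case (high j)
        then show ?thesis using l x \<open>x = i + k\<close> entry_inserted(4)[of j] by (auto intro!: exI[of _ j])
      qed (use l x high entry_inserted(2)[of l] in \<open>auto intro!: exI[of _ l]\<close>)
    next
      assume "\<exists>l\<ge>1. l < i \<and> entry w l = entry w i"
      then obtain l where l: "l \<ge> 1" "l < i" "entry w l = entry w i" by blast
      then show "\<exists>l\<ge>1. l < x \<and> entry w' l = entry w' x"
        using high entry_inserted(2)[of l] entry_inserted(4)[of l] entry_inserted(4)[of i]
        by (intro exI[of _ "bump g k l"]) (auto simp: bump_def)
    qed
    have e: "entry w' x = entry w i" "entry w' (Suc x) = entry w (Suc i)" "x \<in> {1..length w'} \<longleftrightarrow> i \<in> {1..length w}"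
      using high entry_inserted entry_inserted' by auto
    show ?thesis
    proof (cases "i = Suc g")
      case False
      then have "entry w' (x - 1) = entry w (i - 1)" using high entry_inserted'(2)[of i] by simp
      then show ?thesis unfolding R using False first e
        by (auto simp: falls_def free_descent_plateau_def descent_plateau_def)
    next
      case True
      then have p: "entry w' (x - 1) = Suc n" using high entry_inserted' by simp
      show ?thesis
      proof (cases "i \<le> length w")
        case False
        then show ?thesis using R True e by (auto simp: falls_def tops_def)
      next
        case il: True
        have i: "1 \<le> i" using True by simp
        have x: "x \<in> falls m w' \<longleftrightarrow>
          (entry w i > entry w (i + 1) \<and> single_letter m (entry w i)) \<or>
          (entry w i = entry w (i + 1) \<and> \<not> (\<exists>l\<ge>1. l < i \<and> entry w l = entry w i))"
          using first e p entry_inserted'(6)[of i] i il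
          by (auto simp: falls_def free_descent_plateau_def descent_plateau_def)
        show ?thesis
        proof (cases "entry w g" "entry w i" rule: linorder_cases)
          case less
          then show ?thesis unfolding R x using True i il peak_is_single[OF w i il] rise_is_first[OF w _ _ il]
            by (auto simp: falls_def tops_def single_letter_def free_descent_plateau_def descent_plateau_def)
        next
          case equal
          then have "1 < i" "m (entry w i) > 1" using repeated_not_single[OF w i il] True by auto
          then show ?thesis unfolding R x using True i il equal
            by (auto simp: falls_def tops_def single_letter_def free_descent_plateau_def descent_plateau_def)
        next
          case greater
          then show ?thesis unfolding R x using True i il
            by (auto simp: falls_def tops_def single_letter_def free_descent_plateau_def descent_plateau_def)
        qed
      qed
    qed
  qed
qed

lemma card_bump: "card (bump g k ` X) = card X"
  by (rule card_image) (rule inj_on_subset[OF inj_bump], simp)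

lemma card_insert:
  "asc w' = card (ascents w - {g}) + 1"
  "des w' = card (descents w - {g}) + 1"
  "card (tops w') = card (tops w - {g, Suc g}) + 1"
  "card (falls m w') = card (falls m w - {g}) + (if Suc g \<in> tops w then 1 else 0)"
proof -
  have "g \<notin> bump g k ` (ascents w - {g})" "g + k \<notin> bump g k ` (descents w - {g})"
    "Suc g \<notin> bump g k ` (tops w - {g, Suc g})"
    using k by (auto simp: bump_def split: if_splits)
  then show "asc w' = card (ascents w - {g}) + 1" "des w' = card (descents w - {g}) + 1"
    "card (tops w') = card (tops w - {g, Suc g}) + 1"
    unfolding asc_eq des_eq ascents_insert descents_insert tops_insert by (simp_all add: card_bump)
  have "Suc g \<in> tops w \<Longrightarrow> Suc g + k \<notin> bump g k ` (falls m w - {g})"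
    using index_sets_disjoint(3)[of w m] by (auto simp: bump_def split: if_splits)
  then show "card (falls m w') = card (falls m w - {g}) + (if Suc g \<in> tops w then 1 else 0)"
    unfolding falls_insert by (simp add: card_bump)
qed

end

section \<open>The recursion for tops, falls and the remaining indices\<close>

text \<open>A function \<open>f\<close> evaluated at the state \<open>(a, b, c, d)\<close> of a word: the numbers of tops, of ascents
  that do not precede a top, of falls, and of the remaining indices.\<close>
definition state :: "(nat \<Rightarrow> nat) \<Rightarrow> (nat \<Rightarrow> nat \<Rightarrow> nat \<Rightarrow> nat \<Rightarrow> 'a) \<Rightarrow> nat list \<Rightarrow> 'a" where
  "state m f w = f (card (tops w)) (asc w - card (tops w)) (card (falls m w)) (rest m w)"

text \<open>The effect of the gap \<open>g\<close> on the state.  In the first two cases \<open>g\<close> is an ascent, either preceding a top,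
  which is turned into a fall, or not, and then it comes to precede the new top.  In the other cases the new
  ascent replaces an index of the respective kind.  The block consists of a new top and of \<open>k - 1\<close>
  remaining indices.\<close>
lemma state_insert:
  assumes w: "w \<in> stirling_perms n m" and g: "g \<le> length w" and k: "k \<ge> 1" "k = m (Suc n)"
  defines "a \<equiv> card (tops w)" and "b \<equiv> asc w - card (tops w)" and "c \<equiv> card (falls m w)"
    and "d \<equiv> rest m w"
  shows "state m f (ins_block (Suc n) k g w) =
    (if g \<in> {g. Suc g \<in> tops w} then f a b (c + 1) (d + (k - 1))
     else if g \<in> ascents w then f (a + 1) (b - 1) c (d + (k - 1))
     else if g \<in> tops w then f a (b + 1) c (d + (k - 1))
     else if g \<in> falls m w then f (a + 1) b (c - 1) (d + (k - 1))
     else f (a + 1) b c (d - 1 + (k - 1)))" (is "state m f ?w' = _")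
proof -
  note ci = card_insert[OF w g k]
  have t: "asc w + a + c + d = length w + 1" "a \<le> asc w"
    "asc ?w' + card (tops ?w') + card (falls m ?w') + rest m ?w' = length w + k + 1"
    using total_kinds[of w m] tops_le_asc[of w] total_kinds[of ?w' m] g by (auto simp: a_def c_def d_def)
  have b: "b = asc w - a" by (simp add: a_def b_def)
  have asub: "Suc g \<in> tops w \<Longrightarrow> g \<in> ascents w" using pred_tops_subset[of w] g by auto
  have dj: "g \<in> ascents w \<Longrightarrow> g \<notin> tops w \<and> g \<notin> falls m w" "g \<in> tops w \<Longrightarrow> g \<notin> falls m w"
    using index_sets_disjoint(1,4)[of w] index_sets_disjoint(2,3)[of w m] by auto
  have A: "asc ?w' = (if g \<in> ascents w then asc w else asc w + 1)"
    using ci(1) card_Suc_Diff1[of "ascents w" g] by (auto simp: asc_eq)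
  have a0: "Suc g \<in> tops w \<Longrightarrow> 1 \<le> a" "g \<in> tops w \<Longrightarrow> 1 \<le> a"
    unfolding a_def by (erule card_pos_if_mem, simp)+
  have T: "card (tops ?w') = (if Suc g \<in> tops w \<or> g \<in> tops w then a else a + 1)"
  proof -
    consider "Suc g \<in> tops w" "g \<notin> tops w" | "Suc g \<notin> tops w" "g \<in> tops w"
      | "Suc g \<notin> tops w" "g \<notin> tops w" using asub dj(1) by blast
    then show ?thesis
    proof cases
      case 1
      then have "tops w - {g, Suc g} = tops w - {Suc g}" by blast
      then show ?thesis using ci(3) a0(1) 1 by (simp add: a_def)
    next
      case 2
      then have "tops w - {g, Suc g} = tops w - {g}" by blast
      then show ?thesis using ci(3) a0(2) 2 by (simp add: a_def)
    next
      case 3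
      then have "tops w - {g, Suc g} = tops w" by blast
      then show ?thesis using ci(3) 3 by (simp add: a_def)
    qed
  qed
  have c0: "g \<in> falls m w \<Longrightarrow> 1 \<le> c"
    unfolding c_def by (erule card_pos_if_mem, simp)
  have F: "card (falls m ?w') = (if Suc g \<in> tops w then c + 1 else if g \<in> falls m w then c - 1 else c)"
    using ci(4) asub dj(1) by (cases "Suc g \<in> tops w"; cases "g \<in> falls m w") (simp_all add: c_def)
  have d0: "1 \<le> d" if "g \<notin> ascents w" "g \<notin> tops w" "g \<notin> falls m w"
  proof -
    have "g \<in> {0..length w} - ascents w - tops w - falls m w" using that g by auto
    then show ?thesis unfolding d_def rest_def by (rule card_pos_if_mem) simp
  qed
  consider "Suc g \<in> tops w" | "Suc g \<notin> tops w" "g \<in> ascents w" | "g \<notin> ascents w" "g \<in> tops w"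
    | "g \<notin> ascents w" "g \<notin> tops w" "g \<in> falls m w" | "g \<notin> ascents w" "g \<notin> tops w" "g \<notin> falls m w"
    by blast
  then show ?thesis
  proof cases
    case 1
    then have v: "asc ?w' = asc w" "card (tops ?w') = a" "card (falls m ?w') = c + 1"
      using A T F asub dj by auto
    have "rest m ?w' = d + (k - 1)" using t v k(1) by linarith
    moreover have "asc ?w' - card (tops ?w') = b" using t(2) v b by simp
    ultimately show ?thesis using 1 v asub dj by (auto simp add: state_def)
  next
    case 2
    then have v: "asc ?w' = asc w" "card (tops ?w') = a + 1" "card (falls m ?w') = c"
      using A T F asub dj by auto
    have "rest m ?w' = d + (k - 1)" using t v k(1) by linarith
    moreover have "asc ?w' - card (tops ?w') = b - 1" using t(2) v b by simp
    ultimately show ?thesis using 2 v asub dj by (auto simp add: state_def)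
  next
    case 3
    then have v: "asc ?w' = asc w + 1" "card (tops ?w') = a" "card (falls m ?w') = c"
      using A T F asub dj by auto
    have "rest m ?w' = d + (k - 1)" using t v k(1) by linarith
    moreover have "asc ?w' - card (tops ?w') = b + 1" using t(2) v b by simp
    ultimately show ?thesis using 3 v asub dj by (auto simp add: state_def)
  next
    case 4
    then have v: "asc ?w' = asc w + 1" "card (tops ?w') = a + 1" "card (falls m ?w') = c - 1"
      using A T F asub dj by auto
    have "rest m ?w' = d + (k - 1)" using t v k(1) c0[OF 4(3)] by linarith
    moreover have "asc ?w' - card (tops ?w') = b" using t(2) v b by simp
    ultimately show ?thesis using 4 v asub dj by (auto simp add: state_def)
  next
    case 5
    then have v: "asc ?w' = asc w + 1" "card (tops ?w') = a + 1" "card (falls m ?w') = c"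
      using A T F asub dj by auto
    have "rest m ?w' = d - 1 + (k - 1)" using t v k(1) d0[OF 5] by linarith
    moreover have "asc ?w' - card (tops ?w') = b" using t(2) v b by simp
    ultimately show ?thesis using 5 v asub dj by (auto simp add: state_def)
  qed
qed

lemma sum_if_const:
  fixes c :: "'a::comm_semiring_1"
  assumes "finite S"
  shows "(\<Sum>x\<in>S. if x \<in> X then c else h x) = of_nat (card (S \<inter> X)) * c + (\<Sum>x\<in>S - X. h x)"
  using assms by (simp add: sum.If_cases Diff_eq)

text \<open>The operator on functions of states that is dual to inserting a block of \<open>k\<close> letters in all
  possible gaps.  The truncated \<open>b - 1\<close>, \<open>c - 1\<close> and \<open>d - 1\<close> are harmless, as these terms have the
  factors \<open>b\<close>, \<open>c\<close> and \<open>d\<close>.\<close>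
definition ins_op :: "nat \<Rightarrow> (nat \<Rightarrow> nat \<Rightarrow> nat \<Rightarrow> nat \<Rightarrow> 'a) \<Rightarrow>
    nat \<Rightarrow> nat \<Rightarrow> nat \<Rightarrow> nat \<Rightarrow> 'a::comm_semiring_1" where
  "ins_op k f a b c d =
     of_nat a * f a b (c + 1) (d + (k - 1)) + of_nat b * f (a + 1) (b - 1) c (d + (k - 1)) +
     of_nat a * f a (b + 1) c (d + (k - 1)) + of_nat c * f (a + 1) b (c - 1) (d + (k - 1)) +
     of_nat d * f (a + 1) b c (d - 1 + (k - 1))"

lemma sum_state_insert:
  fixes f :: "nat \<Rightarrow> nat \<Rightarrow> nat \<Rightarrow> nat \<Rightarrow> 'a::comm_semiring_1"
  assumes w: "w \<in> stirling_perms n m" and k: "k \<ge> 1" "k = m (Suc n)"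
  shows "(\<Sum>g = 0..length w. state m f (ins_block (Suc n) k g w)) = state m (ins_op k f) w"
proof -
  let ?S = "{0..length w}" and ?X = "{g. Suc g \<in> tops w}"
  note s = index_sets_subset(1,3)[of w] index_sets_subset(2)[of m w]
  note dj = index_sets_disjoint(1,4)[of w] index_sets_disjoint(2,3)[of w m]
  have X: "?S \<inter> ?X = {g \<in> ?S. Suc g \<in> tops w}" by auto
  have XA: "?X \<subseteq> ascents w" using pred_tops_subset[of w] by (auto simp: tops_def)
  have 1: "card (?S \<inter> ?X) = card (tops w)" unfolding X by (rule card_pred_tops)
  have "(?S - ?X) \<inter> ascents w = ascents w - ?S \<inter> ?X" using s by auto
  then have 2: "card ((?S - ?X) \<inter> ascents w) = asc w - card (tops w)"
    using XA 1 by (simp add: card_Diff_subset asc_eq le_infI2)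
  have 3: "(?S - ?X - ascents w) \<inter> tops w = tops w" using s XA dj by auto
  have 4: "(?S - ?X - ascents w - tops w) \<inter> falls m w = falls m w" using s XA dj by auto
  have 5: "card (?S - ?X - ascents w - tops w - falls m w) = rest m w"
    unfolding rest_def using XA by (intro arg_cong[of _ _ card]) auto
  have "(\<Sum>g = 0..length w. state m f (ins_block (Suc n) k g w)) = 
    (\<Sum>g \<in> ?S. (let a = card (tops w); b = asc w - card (tops w); c = card (falls m w); d = rest m w in
     (if g \<in> ?X then f a b (c + 1) (d + (k - 1))
     else if g \<in> ascents w then f (a + 1) (b - 1) c (d + (k - 1))
     else if g \<in> tops w then f a (b + 1) c (d + (k - 1))
     else if g \<in> falls m w then f (a + 1) b (c - 1) (d + (k - 1))
     else f (a + 1) b c (d - 1 + (k - 1)))))"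
    unfolding Let_def by (intro sum.cong refl state_insert[OF w _ k]) auto
  also have "\<dots> = state m (ins_op k f) w"
    unfolding Let_def by (simp only: sum_if_const finite_Diff finite_atLeastAtMost 1 2 3 4 sum_constant 5)
      (simp add: state_def ins_op_def algebra_simps)
  finally show ?thesis .
qed

section \<open>The recursion for ascents, descents and plateaux\<close>

text \<open>The operator of the insertion on functions of \<open>(asc, des, plat)\<close>.\<close>
definition step_op :: "nat \<Rightarrow> (nat \<Rightarrow> nat \<Rightarrow> nat \<Rightarrow> 'a) \<Rightarrow> nat \<Rightarrow> nat \<Rightarrow> nat \<Rightarrow> 'a::comm_semiring_1" where
  "step_op k f a d p =
     of_nat a * f a (d + 1) (p + (k - 1)) + of_nat d * f (a + 1) d (p + (k - 1)) +
     of_nat p * f (a + 1) (d + 1) (p - 1 + (k - 1))"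

lemma sum_step_insert:
  fixes f :: "nat \<Rightarrow> nat \<Rightarrow> nat \<Rightarrow> 'a::comm_semiring_1"
  assumes w: "w \<in> stirling_perms n m" and k: "k \<ge> 1" "k = m (Suc n)"
  shows "(\<Sum>g = 0..length w. let w' = ins_block (Suc n) k g w in f (asc w') (des w') (plat w'))
     = step_op k f (asc w) (des w) (plat w)"
proof -
  let ?S = "{0..length w}" and ?a = "asc w" and ?d = "des w" and ?p = "plat w"
  note s = index_sets_subset(3,4)[of w]
  note dj = index_sets_disjoint(4)[of w]
  have 1: "card (?S \<inter> ascents w) = ?a" unfolding asc_eq using s by (intro arg_cong[of _ _ card]) auto
  have 2: "card ((?S - ascents w) \<inter> descents w) = ?d"
    unfolding des_eq using s dj by (intro arg_cong[of _ _ card]) auto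
  have 3: "card (?S - ascents w - descents w) = ?p"
    unfolding plat_def by (intro arg_cong[of _ _ card]) (auto simp: ascents_def descents_def)
  have "(\<Sum>g = 0..length w. let w' = ins_block (Suc n) k g w in f (asc w') (des w') (plat w')) = 
    (\<Sum>g \<in> ?S. if g \<in> ascents w then f ?a (?d + 1) (?p + (k - 1))
     else if g \<in> descents w then f (?a + 1) ?d (?p + (k - 1))
     else f (?a + 1) (?d + 1) (?p - 1 + (k - 1)))" unfolding Let_def
  proof (rule sum.cong[OF refl], goal_cases)
    case (1 g)
    let ?w' = "ins_block (Suc n) k g w"
    have g: "g \<le> length w" using 1 by simp
    note ci = card_insert[OF w g k]
    have A: "asc ?w' = (if g \<in> ascents w then ?a else ?a + 1)"
      using ci(1) card_Suc_Diff1[of "ascents w" g] by (auto simp: asc_eq)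
    have D: "des ?w' = (if g \<in> descents w then ?d else ?d + 1)"
      using ci(2) card_Suc_Diff1[of "descents w" g] by (auto simp: des_eq)
    have p0: "1 \<le> ?p" if "g \<notin> ascents w" "g \<notin> descents w"
    proof -
      have "g \<in> ?S - ascents w - descents w" using that g by auto
      then show ?thesis unfolding 3[symmetric] by (rule card_pos_if_mem) simp
    qed
    have t: "?a + ?d + ?p = length w + 1" "asc ?w' + des ?w' + plat ?w' = length w + k + 1"
      using total_steps[of w] total_steps[of ?w'] g by auto
    consider "g \<in> ascents w" "g \<notin> descents w" | "g \<notin> ascents w" "g \<in> descents w"
      | "g \<notin> ascents w" "g \<notin> descents w" using dj by blast
    then show ?case
    proof cases
      case 1
      then have "plat ?w' = ?p + (k - 1)" using t k A D by auto
      then show ?thesis using 1 A D by simp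
    next
      case 2
      then have "plat ?w' = ?p + (k - 1)" using t k A D by auto
      then show ?thesis using 2 A D by simp
    next
      case 3
      then have "plat ?w' = ?p - 1 + (k - 1)" using t k A D p0 by auto
      then show ?thesis using 3 A D by simp
    qed
  qed
  also have "\<dots> = step_op k f ?a ?d ?p"
    by (simp only: sum_if_const finite_Diff finite_atLeastAtMost 1 2 3 sum_constant)
      (simp add: step_op_def algebra_simps)
  finally show ?thesis .
qed

section \<open>Decomposition by the largest letter\<close>

lemma ins_block_mem_iff:
  assumes g: "g \<le> length w" and k: "k = m (Suc n)"
  shows "ins_block (Suc n) k g w \<in> stirling_perms (Suc n) m \<longleftrightarrow> w \<in> stirling_perms n m"
    (is "?w' \<in> _ \<longleftrightarrow> _")
proof -
  have "mset ?w' = mset w + replicate_mset k (Suc n)"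
    by (simp add: ins_block_def) (metis append_take_drop_id mset_append)
  then have ms: "mset ?w' = letter_mset (Suc n) m \<longleftrightarrow> mset w = letter_mset n m"
    using k by (simp add: letter_mset_Suc)
  have b: "entry ?w' (bump g k i) = entry w i" for i by (rule entry_ins_block_bump[OF g])
  show ?thesis
  proof
    assume w': "?w' \<in> stirling_perms (Suc n) m"
    show "w \<in> stirling_perms n m" unfolding stirling_perms_def permutations_of_multiset_def mem_Collect_eq
    proof (intro conjI ballI allI impI)
      show "mset w = letter_mset n m" using stirling_mset[OF w'] ms by simp
      fix i x y z
      assume "i \<in> {1..n}" and *: "1 \<le> x \<and> x < y \<and> y < z \<and> z \<le> length w \<and> entry w x = i \<and> entry w z = i"
      have "entry ?w' (bump g k x) \<le> entry ?w' (bump g k y)"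
        using * by (intro stirling_between[OF w', where c = "bump g k z"]) (auto simp: b g, auto simp: bump_def)
      then show "i \<le> entry w y" using * b by simp
    qed
  next
    assume w: "w \<in> stirling_perms n m"
    show "?w' \<in> stirling_perms (Suc n) m"
      unfolding stirling_perms_def permutations_of_multiset_def mem_Collect_eq
    proof (intro conjI ballI allI impI)
      show "mset ?w' = letter_mset (Suc n) m" using stirling_mset[OF w] ms by simp
      fix i x y z
      assume "i \<in> {1..Suc n}"
        and *: "1 \<le> x \<and> x < y \<and> y < z \<and> z \<le> length ?w' \<and> entry ?w' x = i \<and> entry ?w' z = i"
      have cases: "(\<exists>j. x = bump g k j) \<or> (g < x \<and> x \<le> g + k)" for x
      proof (cases x rule: index_cases[where g = g and k = k])
        case (high j)
        then have "x = bump g k j" by (simp add: bump_def)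
        then show ?thesis by blast
      qed (auto simp: bump_def intro: exI[of _ x])
      show "i \<le> entry ?w' y"
      proof (cases "g < y \<and> y \<le> g + k")
        case True
        then show ?thesis using entry_ins_block_block[OF g, of y k "Suc n"] \<open>i \<in> _\<close> by simp
      next
        case y: False
        then have "\<not> ((g < x \<and> x \<le> g + k) \<and> (g < z \<and> z \<le> g + k))" using * by auto
        then have "entry ?w' x \<noteq> Suc n \<or> entry ?w' z \<noteq> Suc n"
          using cases[of x] cases[of z] b entry_le[OF w] by (metis Suc_n_not_le_n)
        then have "i \<noteq> Suc n" using * by auto
        then have "\<not> (g < x \<and> x \<le> g + k)" "\<not> (g < z \<and> z \<le> g + k)"
          using * entry_ins_block_block[OF g, of x k "Suc n"] entry_ins_block_block[OF g, of z k "Suc n"] by auto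
        then obtain x' y' z' where xyz: "x = bump g k x'" "y = bump g k y'" "z = bump g k z'"
          using cases y by metis
        then have "entry w x' \<le> entry w y'"
          using * b g by (intro stirling_between[OF w, where c = z']) (auto, auto simp: bump_def split: if_splits)
        then show ?thesis using * b xyz by simp
      qed
    qed
  qed
qed

text \<open>The copies of the largest letter are adjacent: an entry between two of them would be at least as large.\<close>
lemma stirling_perms_Suc_decompose:
  assumes w: "w \<in> stirling_perms (Suc n) m" and k: "k \<ge> 1" "k = m (Suc n)"
  obtains g v where "v \<in> stirling_perms n m" "g \<le> length v" "w = ins_block (Suc n) k g v"
proof -
  define u where "u = takeWhile (\<lambda>x. x \<noteq> Suc n) w"
  define r where "r = dropWhile (\<lambda>x. x \<noteq> Suc n) w"
  define b where "b = takeWhile (\<lambda>x. x = Suc n) r"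
  define v where "v = dropWhile (\<lambda>x. x = Suc n) r"
  have eq: "w = u @ b @ v" by (simp add: u_def r_def b_def v_def)
  have cnt: "count (mset w) (Suc n) = k" using stirling_mset[OF w] k by (simp add: count_letter_mset)
  then have "Suc n \<in> set w" using k(1) count_mset_0_iff[of w "Suc n"] by linarith
  then have "r \<noteq> []" by (simp add: r_def)
  then have "hd r = Suc n" using hd_dropWhile[of "\<lambda>x. x \<noteq> Suc n" w] by (simp add: r_def)
  then have "b \<noteq> []" using \<open>r \<noteq> []\<close> by (cases r) (auto simp: b_def)
  have b: "b = replicate (length b) (Suc n)"
  proof -
    have "\<forall>y\<in>set b. y = Suc n" unfolding b_def by (auto dest: set_takeWhileD)
    then show ?thesis using replicate_length_same[of b "Suc n"] by simp
  qed
  have u: "Suc n \<notin> set u" by (auto simp: u_def dest: set_takeWhileD)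
  have v: "Suc n \<notin> set v"
  proof
    assume "Suc n \<in> set v"
    then obtain j where j: "j < length v" "v ! j = Suc n" by (auto simp: in_set_conv_nth)
    then have "v \<noteq> []" by auto
    then have "hd v \<noteq> Suc n" using hd_dropWhile[of "\<lambda>x. x = Suc n" r] by (simp add: v_def)
    then have v0: "v ! 0 \<noteq> Suc n" using \<open>v \<noteq> []\<close> by (simp add: hd_conv_nth)
    have "j \<noteq> 0" using j(2) v0 by metis
    \<comment> \<open>The entry after the block \<open>b\<close> is too small to lie between its end and the copy in \<open>v\<close>.\<close>
    let ?a = "length u + length b"
    have lb: "1 \<le> length b" using \<open>b \<noteq> []\<close> by (simp add: Suc_le_eq)
    then have last: "b ! (length b - 1) = Suc n" by (subst b) simp
    have "?a - 1 = length u + (length b - 1)" using lb by simp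
    then have "w ! (?a - 1) = (b @ v) ! (length b - 1)" unfolding eq by (simp only: nth_append_length_plus)
    also have "\<dots> = Suc n"
    proof -
      have "length b - 1 < length b" using lb by linarith
      then show ?thesis using last by (simp only: nth_append if_True)
    qed
    finally have 1: "entry w ?a = Suc n" using lb by (simp add: entry_def eq)
    have 2: "entry w (?a + 1) = v ! 0" "entry w (?a + 1 + j) = Suc n"
      using j by (auto simp: entry_def eq nth_append)
    have "entry w ?a \<le> entry w (?a + 1)"
      using \<open>b \<noteq> []\<close> \<open>j \<noteq> 0\<close> j 1 2 by (intro stirling_between[OF w, where c = "?a + 1 + j"]) (auto simp: eq Suc_le_eq)
    then show False using 1 2 v0 entry_le[OF w, of "?a + 1"] by simp
  qed
  have "count (mset w) (Suc n) = count (mset b) (Suc n)" using u v by (simp add: eq count_list_0_iff)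
  also have "\<dots> = length b" by (subst b) simp
  finally have "b = replicate k (Suc n)" using b cnt by metis
  then have w': "w = ins_block (Suc n) k (length u) (u @ v)" using eq by (simp add: ins_block_def)
  then have "u @ v \<in> stirling_perms n m" using w ins_block_mem_iff[of "length u" "u @ v" k m n] k by simp
  then show ?thesis using that[of "u @ v" "length u"] w' by simp
qed

text \<open>Deleting the letter \<open>N\<close> recovers the word, and the length of the prefix without \<open>N\<close> the gap.\<close>
lemma ins_block_inj:
  assumes "ins_block N k g w = ins_block N k g' w'" "N \<notin> set w" "N \<notin> set w'" "k \<ge> 1"
    "g \<le> length w" "g' \<le> length w'"
  shows "g = g' \<and> w = w'"
proof -
  have f: "filter (\<lambda>x. x \<noteq> N) (ins_block N k g w) = w" if "N \<notin> set w" for g w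
  proof -
    have "filter (\<lambda>x. x \<noteq> N) (take g w) = take g w" "filter (\<lambda>x. x \<noteq> N) (drop g w) = drop g w"
      using that by (auto simp: filter_id_conv dest: in_set_takeD in_set_dropD)
    then show ?thesis by (simp add: ins_block_def)
  qed
  have t: "takeWhile (\<lambda>x. x \<noteq> N) (ins_block N k g w) = take g w" if "N \<notin> set w" for g w
  proof -
    have "N \<notin> set (take g w)" using that by (auto dest: in_set_takeD)
    then show ?thesis using \<open>k \<ge> 1\<close> by (cases k) (auto simp: ins_block_def takeWhile_append)
  qed
  have "w = w'" using f[OF assms(2), of g] f[OF assms(3), of g'] assms(1) by simp
  moreover have "take g w = take g' w'" using t[OF assms(2), of g] t[OF assms(3), of g'] assms(1) by simp
  ultimately show ?thesis using assms(5,6) by (metis length_take min.absorb2)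
qed

lemma finite_stirling_perms [simp]: "finite (stirling_perms n m)"
  by (simp add: stirling_perms_def)

lemma sum_stirling_perms_Suc:
  assumes k: "k \<ge> 1" "k = m (Suc n)"
  shows "(\<Sum>w\<in>stirling_perms (Suc n) m. h w) =
    (\<Sum>w\<in>stirling_perms n m. \<Sum>g = 0..length w. h (ins_block (Suc n) k g w))"
proof -
  let ?S = "SIGMA w:stirling_perms n m. {0..length w}"
  have "inj_on (\<lambda>(w, g). ins_block (Suc n) k g w) ?S"
  proof (rule inj_onI, clarify)
    fix w g w' g'
    assume "w \<in> stirling_perms n m" "w' \<in> stirling_perms n m" "g \<in> {0..length w}" "g' \<in> {0..length w'}"
      and eq: "ins_block (Suc n) k g w = ins_block (Suc n) k g' w'"
    moreover from this have "Suc n \<notin> set w" "Suc n \<notin> set w'" using stirling_set by fastforce+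
    ultimately show "w = w' \<and> g = g'" using ins_block_inj[OF eq] k by auto
  qed
  moreover have "(\<lambda>(w, g). ins_block (Suc n) k g w) ` ?S = stirling_perms (Suc n) m"
  proof (intro equalityI subsetI)
    fix w assume "w \<in> stirling_perms (Suc n) m"
    then show "w \<in> (\<lambda>(w, g). ins_block (Suc n) k g w) ` ?S"
      by (rule stirling_perms_Suc_decompose[where m = m and n = n, OF _ k]) force
  qed (use ins_block_mem_iff k in auto)
  ultimately have "(\<Sum>w\<in>stirling_perms (Suc n) m. h w) = (\<Sum>p\<in>?S. h (case p of (w, g) \<Rightarrow> ins_block (Suc n) k g w))"
    by (metis (no_types, lifting) comp_apply sum.cong sum.reindex)
  also have "\<dots> = (\<Sum>w\<in>stirling_perms n m. \<Sum>g = 0..length w. h (ins_block (Suc n) k g w))"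
    by (subst sum.Sigma) (auto intro!: sum.cong)
  finally show ?thesis .
qed

section \<open>Equidistribution\<close>

lemma stirling_perms_0: "stirling_perms 0 m = {[]}"
  by (auto simp: stirling_perms_def letter_mset_def)

lemma stats_Nil: "asc [] = 0" "des [] = 0" "plat [] = 1" "tops [] = {}" "falls m [] = {}" "rest m [] = 1"
  by (simp_all add: asc_def des_def plat_def tops_def falls_def rest_def ascents_def entry_def)

lemma sum_state_Suc:
  fixes f :: "nat \<Rightarrow> nat \<Rightarrow> nat \<Rightarrow> nat \<Rightarrow> 'a::comm_semiring_1"
  assumes "m (Suc n) \<ge> 1"
  shows "(\<Sum>w\<in>stirling_perms (Suc n) m. state m f w) = (\<Sum>w\<in>stirling_perms n m. state m (ins_op (m (Suc n)) f) w)"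
  unfolding sum_stirling_perms_Suc[where m = m and n = n, OF assms refl]
  by (rule sum.cong[OF refl]) (rule sum_state_insert[where m = m and n = n, OF _ assms refl])

lemma sum_step_Suc:
  fixes f :: "nat \<Rightarrow> nat \<Rightarrow> nat \<Rightarrow> 'a::comm_semiring_1"
  assumes "m (Suc n) \<ge> 1"
  shows "(\<Sum>w\<in>stirling_perms (Suc n) m. f (asc w) (des w) (plat w))
    = (\<Sum>w\<in>stirling_perms n m. step_op (m (Suc n)) f (asc w) (des w) (plat w))"
  unfolding sum_stirling_perms_Suc[where m = m and n = n, OF assms refl]
  by (rule sum.cong[OF refl])
    (rule sum_step_insert[where m = m and n = n, unfolded Let_def, OF _ assms refl])

text \<open>For nonempty words this says that \<open>(asc, des, plat)\<close> and
  \<open>(asc, ascpp + sddes + fdesp, mdup)\<close> have the same joint distribution.\<close>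
theorem asc_des_plat_equidistributed:
  fixes f :: "nat \<Rightarrow> nat \<Rightarrow> nat \<Rightarrow> 'a::comm_semiring_1"
  assumes "\<forall>i\<in>{1..n}. m i \<ge> 1"
  shows "(\<Sum>w\<in>stirling_perms n m. f (asc w) (des w) (plat w))
    = (\<Sum>w\<in>stirling_perms n m. state m (\<lambda>a b c d. f (a + b) (a + c) d) w)"
  using assms
proof (induction n arbitrary: f)
  case 0
  show ?case by (simp add: stirling_perms_0 stats_Nil state_def)
next
  case (Suc n)
  let ?k = "m (Suc n)"
  have k: "?k \<ge> 1" using Suc.prems by auto
  have "ins_op ?k (\<lambda>a b c d. f (a + b) (a + c) d) = (\<lambda>a b c d. step_op ?k f (a + b) (a + c) d)"
  proof (intro ext)
    fix a b c d
    have "of_nat b * f (a + 1 + (b - 1)) (a + 1 + c) (d + (?k - 1)) = of_nat b * f (a + b) (a + c + 1) (d + (?k - 1))"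
      by (cases b) auto
    moreover have "of_nat c * f (a + 1 + b) (a + 1 + (c - 1)) (d + (?k - 1)) = of_nat c * f (a + b + 1) (a + c) (d + (?k - 1))"
      by (cases c) auto
    ultimately show "ins_op ?k (\<lambda>a b c d. f (a + b) (a + c) d) a b c d = step_op ?k f (a + b) (a + c) d"
      by (simp add: ins_op_def step_op_def algebra_simps)
  qed
  then show ?case using Suc.IH[of "step_op ?k f"] Suc.prems
    by (simp add: sum_state_Suc[where m = m and n = n, OF k] sum_step_Suc[where m = m and n = n, OF k])
qed

section \<open>Binomial transforms and the symmetry of the state distribution\<close>

text \<open>\<open>binom_transform b h\<close> is the sum of \<open>(b choose j) * h (b - j) j\<close> over \<open>j \<le> b\<close>, defined by Pascal's rule.  It
  expresses the substitution of \<open>x + y\<close> for a variable: if \<open>h i j\<close> is the value of a linear functional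
  at \<open>x\<^sup>i y\<^sup>j\<close>, then \<open>binom_transform b h\<close> is its value at \<open>(x + y)\<^sup>b\<close>.\<close>
primrec binom_transform :: "nat \<Rightarrow> (nat \<Rightarrow> nat \<Rightarrow> 'a) \<Rightarrow> 'a::comm_semiring_1" where
  "binom_transform 0 h = h 0 0"
| "binom_transform (Suc b) h = binom_transform b (\<lambda>i j. h (Suc i) j + h i (Suc j))"

lemma binom_transform_add: "binom_transform b (\<lambda>i j. h i j + h' i j) = binom_transform b h + binom_transform b h'"
proof (induction b arbitrary: h h')
  case (Suc b)
  show ?case using Suc[of "\<lambda>i j. h (Suc i) j + h i (Suc j)" "\<lambda>i j. h' (Suc i) j + h' i (Suc j)"]
    by (simp add: algebra_simps)
qed simp

lemma binom_transform_scale: "binom_transform b (\<lambda>i j. c * h i j) = c * binom_transform b h"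
proof (induction b arbitrary: h)
  case (Suc b)
  show ?case using Suc[of "\<lambda>i j. h (Suc i) j + h i (Suc j)"] by (simp add: algebra_simps)
qed simp

text \<open>The image of \<open>(x + y)\<^sup>b\<close> under \<open>\<partial>/\<partial>x + \<partial>/\<partial>y\<close> is \<open>2 b (x + y)\<^sup>b\<^sup>-\<^sup>1\<close>.\<close>
lemma binom_transform_lower:
  "binom_transform b (\<lambda>i j. of_nat i * h (i - 1) j + of_nat j * h i (j - 1)) = 2 * of_nat b * binom_transform (b - 1) h"
proof (induction b arbitrary: h)
  case (Suc b)
  let ?h = "\<lambda>i j. h (Suc i) j + h i (Suc j)"
  have "(\<lambda>i j. of_nat (Suc i) * h (Suc i - 1) j + of_nat j * h (Suc i) (j - 1) +
      (of_nat i * h (i - 1) (Suc j) + of_nat (Suc j) * h i (Suc j - 1)))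
    = (\<lambda>i j. 2 * h i j + (of_nat i * ?h (i - 1) j + of_nat j * ?h i (j - 1)))"
  proof (intro ext)
    fix i j
    have "of_nat i * ?h (i - 1) j = of_nat i * h i j + of_nat i * h (i - 1) (Suc j)"
      by (cases i) (auto simp: algebra_simps)
    moreover have "of_nat j * ?h i (j - 1) = of_nat j * h (Suc i) (j - 1) + of_nat j * h i j"
      by (cases j) (auto simp: algebra_simps)
    ultimately show "of_nat (Suc i) * h (Suc i - 1) j + of_nat j * h (Suc i) (j - 1) +
      (of_nat i * h (i - 1) (Suc j) + of_nat (Suc j) * h i (Suc j - 1))
      = 2 * h i j + (of_nat i * ?h (i - 1) j + of_nat j * ?h i (j - 1))"
      by (simp add: algebra_simps mult_2)
  qed
  then have "binom_transform (Suc b) (\<lambda>i j. of_nat i * h (i - 1) j + of_nat j * h i (j - 1))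
    = binom_transform b (\<lambda>i j. 2 * h i j + (of_nat i * ?h (i - 1) j + of_nat j * ?h i (j - 1)))"
    unfolding binom_transform.simps by (rule arg_cong[where f = "binom_transform b"])
  also have "\<dots> = 2 * binom_transform b h + binom_transform b (\<lambda>i j. of_nat i * ?h (i - 1) j + of_nat j * ?h i (j - 1))"
    unfolding binom_transform_add[of b "\<lambda>i j. 2 * h i j"] binom_transform_scale ..
  also have "binom_transform b (\<lambda>i j. of_nat i * ?h (i - 1) j + of_nat j * ?h i (j - 1)) = 2 * of_nat b * binom_transform (b - 1) ?h"
    by (rule Suc)
  also have "2 * of_nat b * binom_transform (b - 1) ?h = 2 * of_nat b * binom_transform b h" by (cases b) auto
  finally show ?case by (simp add: algebra_simps)
qed simp

text \<open>The right-hand side involves \<open>f\<close> only through its binomial transforms in the second and third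
  arguments.  Dually, inserting blocks preserves generating functions in which the variables of \<open>b\<close> and
  \<open>c\<close> occur only through their sum.\<close>
lemma binom_transform_ins_op:
  "binom_transform b (\<lambda>i j. ins_op k f a i j d) =
     of_nat a * binom_transform (Suc b) (\<lambda>i j. f a i j (d + (k - 1))) +
     2 * of_nat b * binom_transform (b - 1) (\<lambda>i j. f (a + 1) i j (d + (k - 1))) +
     of_nat d * binom_transform b (\<lambda>i j. f (a + 1) i j (d - 1 + (k - 1)))"
proof -
  let ?F = "\<lambda>i j. f a i j (d + (k - 1))" and ?G = "\<lambda>i j. f (a + 1) i j (d + (k - 1))"
  let ?H = "\<lambda>i j. of_nat a * (?F (Suc i) j + ?F i (Suc j))"
    and ?L = "\<lambda>i j. of_nat i * ?G (i - 1) j + of_nat j * ?G i (j - 1)"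
    and ?M = "\<lambda>i j. of_nat d * f (a + 1) i j (d - 1 + (k - 1))"
  have "binom_transform b (\<lambda>i j. ins_op k f a i j d) = binom_transform b (\<lambda>i j. (?H i j + ?L i j) + ?M i j)"
    by (intro arg_cong[where f = "binom_transform b"] ext) (simp add: ins_op_def algebra_simps)
  also have "\<dots> = binom_transform b ?H + binom_transform b ?L + binom_transform b ?M"
    unfolding binom_transform_add[of b "\<lambda>i j. ?H i j + ?L i j" ?M] binom_transform_add[of b ?H ?L] ..
  also have "binom_transform b ?H = of_nat a * binom_transform (Suc b) ?F" unfolding binom_transform.simps by (rule binom_transform_scale)
  also have "binom_transform b ?L = 2 * of_nat b * binom_transform (b - 1) ?G" by (rule binom_transform_lower)
  also have "binom_transform b ?M = of_nat d * binom_transform b (\<lambda>i j. f (a + 1) i j (d - 1 + (k - 1)))" by (rule binom_transform_scale)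
  finally show ?thesis .
qed

text \<open>Hence the sum of \<open>f\<close> over all states is determined by the binomial transforms of \<open>f\<close>.  This is the
  statement that the generating function of the states depends on the variables of \<open>b\<close> and \<open>c\<close> only
  through their sum.\<close>
lemma sum_state_cong:
  fixes f f' :: "nat \<Rightarrow> nat \<Rightarrow> nat \<Rightarrow> nat \<Rightarrow> 'a::comm_semiring_1"
  assumes "\<forall>i\<in>{1..n}. m i \<ge> 1"
    and "\<And>a b d. binom_transform b (\<lambda>i j. f a i j d) = binom_transform b (\<lambda>i j. f' a i j d)"
  shows "(\<Sum>w\<in>stirling_perms n m. state m f w) = (\<Sum>w\<in>stirling_perms n m. state m f' w)"
  using assms
proof (induction n arbitrary: f f')
  case 0
  have "f 0 0 0 1 = f' 0 0 0 1" using "0.prems"(2)[of 0 0 1] by (simp only: binom_transform.simps)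
  then show ?case by (simp add: stirling_perms_0 stats_Nil state_def)
next
  case (Suc n)
  have k: "m (Suc n) \<ge> 1" using Suc.prems by auto
  show ?case unfolding sum_state_Suc[where m = m and n = n, OF k]
    by (rule Suc.IH) (use Suc.prems(1) in \<open>auto simp: binom_transform_ins_op Suc.prems(2) simp del: binom_transform.simps\<close>)
qed

lemma binom_transform_powers: "binom_transform b (\<lambda>i j. x ^ i * y ^ j) = (x + y) ^ b"
proof (induction b)
  case (Suc b)
  have "(\<lambda>i j. x ^ Suc i * y ^ j + x ^ i * y ^ Suc j) = (\<lambda>i j. (x + y) * (x ^ i * y ^ j))"
    by (intro ext) (simp add: algebra_simps)
  then show ?case by (simp only: binom_transform.simps binom_transform_scale Suc power_Suc)
qed simp

lemma binom_transform_first: "binom_transform b (\<lambda>i j. if j = 0 then h i else 0) = h b"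
proof (induction b arbitrary: h)
  case (Suc b)
  show ?case using Suc[of "\<lambda>i. h (Suc i)"] by simp
qed simp

section \<open>The expansion\<close>

text \<open>The weights \<open>x\<^sup>b y\<^sup>c\<close> and \<open>(x + y)\<^sup>b\<close> restricted to \<open>c = 0\<close> have the same binomial transform
  \<open>(x + y)\<^sup>b\<close>.\<close>
theorem stirling_sum_gamma:
  fixes x y z :: "'a::comm_semiring_1"
  assumes m: "\<forall>i\<in>{1..n}. m i \<ge> 1"
  shows "(\<Sum>w\<in>stirling_perms n m. x ^ asc w * y ^ des w * z ^ plat w) =
    (\<Sum>w\<in>{w \<in> stirling_perms n m. sddes m w = 0 \<and> fdesp w = 0}.
      (x * y) ^ ascpp w * (x + y) ^ (asc w - ascpp w) * z ^ rest m w)"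
proof -
  let ?f = "\<lambda>a b c d. (x * y) ^ a * z ^ d * (x ^ b * y ^ c)"
  let ?g = "\<lambda>a b c d. (x * y) ^ a * z ^ d * (if c = 0 then (x + y) ^ b else 0)"
  have "(\<Sum>w\<in>stirling_perms n m. x ^ asc w * y ^ des w * z ^ plat w) =
    (\<Sum>w\<in>stirling_perms n m. state m (\<lambda>a b c d. x ^ (a + b) * y ^ (a + c) * z ^ d) w)"
    by (rule asc_des_plat_equidistributed[OF m])
  also have "(\<lambda>a b c d. x ^ (a + b) * y ^ (a + c) * z ^ d) = ?f"
    by (intro ext) (simp add: power_add power_mult_distrib ac_simps)
  also have "(\<Sum>w\<in>stirling_perms n m. state m ?f w) = (\<Sum>w\<in>stirling_perms n m. state m ?g w)"
    by (rule sum_state_cong[OF m]) (simp only: binom_transform_scale binom_transform_powers binom_transform_first)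
  also have "\<dots> = (\<Sum>w\<in>stirling_perms n m. if sddes m w = 0 \<and> fdesp w = 0 then
      (x * y) ^ ascpp w * (x + y) ^ (asc w - ascpp w) * z ^ rest m w else 0)"
    by (rule sum.cong) (auto simp: state_def ascpp_eq falls_eq ac_simps)
  also have "\<dots> = (\<Sum>w\<in>{w \<in> stirling_perms n m. sddes m w = 0 \<and> fdesp w = 0}.
      (x * y) ^ ascpp w * (x + y) ^ (asc w - ascpp w) * z ^ rest m w)"
    by (rule sum.inter_filter[symmetric]) simp
  finally show ?thesis .
qed

text \<open>The first index that is not an ascent is a top.\<close>
lemma ascpp_pos:
  assumes w: "w \<in> stirling_perms n m" and "w \<noteq> []"
  shows "1 \<le> ascpp w"
proof -
  let ?P = "\<lambda>i. entry w (i + 1) \<le> entry w i"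
  have "?P (length w)" by (simp add: entry_def)
  moreover have "\<not> ?P 0" using stirling_entry(1)[OF w, of 1] assms by (cases w) (auto simp: entry_def)
  ultimately obtain i where i: "i \<le> length w" "\<forall>j<i. \<not> ?P j" "?P i" "i \<noteq> 0"
    using ex_least_nat_le[of ?P "length w"] by metis
  then have "\<not> ?P (i - 1)" using i(2)[rule_format, of "i - 1"] by simp
  then have "i \<in> tops w" using i by (auto simp: tops_def)
  then show ?thesis unfolding ascpp_eq by (rule card_pos_if_mem) simp
qed

lemma stirling_sum_gamma_coeff:
  fixes x y z :: "'a::comm_semiring_1"
  assumes "n \<ge> 1" and m: "\<forall>i\<in>{1..n}. m i \<ge> 1" and s: "s = (\<Sum>i=1..n. m i)"
  shows "(\<Sum>w\<in>stirling_perms n m. x ^ asc w * y ^ des w * z ^ plat w) =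
      (\<Sum>i=0..s - 1. z ^ i * (\<Sum>j=1..(s + 1 - i) div 2.
        of_nat (gamma_coeff n m i j) * (x * y) ^ j * (x + y) ^ (s + 1 - i - 2 * j)))"
proof -
  let ?G = "{w \<in> stirling_perms n m. sddes m w = 0 \<and> fdesp w = 0}"
  let ?T = "SIGMA i:{0..s - 1}. {1..(s + 1 - i) div 2}"
  let ?t = "\<lambda>(i, j). z ^ i * ((x * y) ^ j * (x + y) ^ (s + 1 - i - 2 * j))"
  let ?st = "\<lambda>w. (mdup m w, ascpp w)"
  have "m 1 \<le> s" unfolding s using \<open>n \<ge> 1\<close> by (intro member_le_sum) auto
  moreover have "m 1 \<ge> 1" using assms by auto
  ultimately have "s \<ge> 1" by simp
  have G: "rest m w = mdup m w" "asc w + ascpp w + mdup m w = s + 1" "1 \<le> ascpp w" "ascpp w \<le> asc w"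
    if "w \<in> ?G" for w
  proof -
    have w: "w \<in> stirling_perms n m" using that by simp
    have "length w = s" using stirling_length[OF w] s by simp
    then have "w \<noteq> []" using \<open>s \<ge> 1\<close> by auto
    then show "rest m w = mdup m w" "1 \<le> ascpp w" using rest_eq_mdup[OF w m] ascpp_pos[OF w] by auto
    then show "asc w + ascpp w + mdup m w = s + 1" "ascpp w \<le> asc w"
      using total_kinds[of w m] tops_le_asc[of w] that \<open>length w = s\<close> by (auto simp: ascpp_eq falls_eq)
  qed
  have "(\<Sum>w\<in>stirling_perms n m. x ^ asc w * y ^ des w * z ^ plat w) = (\<Sum>w\<in>?G. ?t (?st w))"
    unfolding stirling_sum_gamma[OF m]
  proof (rule sum.cong[OF refl])
    fix w assume w: "w \<in> ?G"
    have "asc w - ascpp w = s + 1 - mdup m w - 2 * ascpp w" using G(2-4)[OF w] by linarith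
    then show "(x * y) ^ ascpp w * (x + y) ^ (asc w - ascpp w) * z ^ rest m w = ?t (?st w)"
      using G(1)[OF w] by (simp add: ac_simps)
  qed
  also have "\<dots> = (\<Sum>p\<in>?T. \<Sum>w\<in>{w \<in> ?G. ?st w = p}. ?t (?st w))"
  proof (rule sum.group[symmetric])
    show "?st ` ?G \<subseteq> ?T"
    proof (rule image_subsetI)
      fix w assume w: "w \<in> ?G"
      show "?st w \<in> ?T" using G(2-4)[OF w] by auto
    qed
  qed simp_all
  also have "\<dots> = (\<Sum>(i, j)\<in>?T. z ^ i * (of_nat (gamma_coeff n m i j) * (x * y) ^ j * (x + y) ^ (s + 1 - i - 2 * j)))"
  proof (rule sum.cong[OF refl])
    fix p :: "nat \<times> nat"
    obtain i j where p: "p = (i, j)" by (rule prod.exhaust)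
    have "{w \<in> ?G. ?st w = (i, j)} = {w \<in> stirling_perms n m.
      sddes m w = 0 \<and> fdesp w = 0 \<and> mdup m w = i \<and> ascpp w = j}" by auto
    moreover have "(\<Sum>w\<in>{w \<in> ?G. ?st w = (i, j)}. ?t (?st w)) = (\<Sum>w\<in>{w \<in> ?G. ?st w = (i, j)}. ?t (i, j))"
      by (rule sum.cong) auto
    ultimately show "(\<Sum>w\<in>{w \<in> ?G. ?st w = p}. ?t (?st w)) = (case p of (i, j) \<Rightarrow>
      z ^ i * (of_nat (gamma_coeff n m i j) * (x * y) ^ j * (x + y) ^ (s + 1 - i - 2 * j)))"
      unfolding p by (simp add: gamma_coeff_def ac_simps)
  qed
  also have "\<dots> = (\<Sum>i=0..s - 1. \<Sum>j=1..(s + 1 - i) div 2.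
      z ^ i * (of_nat (gamma_coeff n m i j) * (x * y) ^ j * (x + y) ^ (s + 1 - i - 2 * j)))"
    by (rule sum.Sigma[symmetric]) auto
  finally show ?thesis by (simp add: sum_distrib_left)
qed

section \<open>Partial gamma-positivity\<close>

lemma sum_const_poly: "(\<Sum>x\<in>A. [:f x:]) = [:\<Sum>x\<in>A. f x:]"
  by (induction A rule: infinite_finite_induct) auto

lemma Z3_power_mult: "Z3 ^ i * [:h:] = monom h i"
  by (simp add: Z3_def monom_altdef)

theorem theorem1p3:
  fixes n :: nat and m :: "nat \<Rightarrow> nat" and s :: nat
  assumes "n \<ge> 1"
    and "\<forall>i\<in>{1..n}. m i \<ge> 1"
    and "s = (\<Sum>i=1..n. m i)"
  shows "partial_gamma_positive (stirling_poly n m) \<and>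
    stirling_poly n m =
      (\<Sum>i=0..s - 1. Z3 ^ i * (\<Sum>j=1..(s + 1 - i) div 2.
        of_nat (gamma_coeff n m i j) * (X3 * Y3) ^ j * (X3 + Y3) ^ (s + 1 - i - 2 * j)))"
proof
  let ?h = "\<lambda>i. \<Sum>j=1..(s + 1 - i) div 2.
    of_nat (gamma_coeff n m i j) * (X2 * Y2) ^ j * (X2 + Y2) ^ (s + 1 - i - 2 * j)"
  show expansion: "stirling_poly n m =
      (\<Sum>i=0..s - 1. Z3 ^ i * (\<Sum>j=1..(s + 1 - i) div 2.
        of_nat (gamma_coeff n m i j) * (X3 * Y3) ^ j * (X3 + Y3) ^ (s + 1 - i - 2 * j)))"
    unfolding stirling_poly_def by (rule stirling_sum_gamma_coeff[OF assms])
  have "(\<Sum>j=1..(s + 1 - i) div 2.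
      of_nat (gamma_coeff n m i j) * (X3 * Y3) ^ j * (X3 + Y3) ^ (s + 1 - i - 2 * j)) = [:?h i:]" for i
    by (simp add: X3_def Y3_def poly_const_pow of_nat_poly ac_simps flip: sum_const_poly)
  then have "stirling_poly n m = (\<Sum>i=0..s - 1. monom (?h i) i)"
    unfolding expansion by (simp only: Z3_power_mult)
  then have coeff: "coeff (stirling_poly n m) i = (if i \<le> s - 1 then ?h i else 0)" for i
    by (simp add: coeff_sum coeff_monom sum.delta)
  show "partial_gamma_positive (stirling_poly n m)" unfolding partial_gamma_positive_def
  proof
    fix i
    \<comment> \<open>The sum in the expansion starts at \<open>j = 1\<close>, so the coefficient of index 0 is 0.\<close>
    let ?c = "\<lambda>j. if i \<le> s - 1 \<and> j \<noteq> 0 then real (gamma_coeff n m i j) else 0"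
    have "coeff (stirling_poly n m) i = (\<Sum>j=0..(s + 1 - i) div 2.
      [:[:?c j:]:] * (X2 * Y2) ^ j * (X2 + Y2) ^ (s + 1 - i - 2 * j))"
      unfolding coeff by (auto simp: sum.atLeast_Suc_atMost of_nat_poly intro!: sum.cong)
    then show "homogeneous_gamma_positive (coeff (stirling_poly n m) i)"
      unfolding homogeneous_gamma_positive_def by (intro exI[of _ "s + 1 - i"] exI[of _ ?c]) auto
  qed
qed

end
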